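(* For all $m,n\in\mathbb{N}$, $$T(n,m)=u_{m+1}^{T}A_{m+1}^{\,n}\,v_{m+1,1}.$$ (For $n\ge 1$ the right-hand side also equals $u_{m+1}^TA_{m+1}^{n-1}u_{m+1}$.)
   Context: $T(n,m)$, $n,m\in\mathbb{N}$, is the array defined by $T(n,0)=1$ for all $n\in\mathbb{N}$ and, for $m\ge 1$, $T(n,m)=T(n,m-1)+\sum_{k=0}^{\lfloor (n-1)/2\rfloor}T(2k,m-1)\,T(n-1-2k,m)$ (the sum is empty when $n=0$). For a positive integer $m$, $A_m$ is the $m\times m$ matrix whose $(i,j)$ entry is $1$ if $i+j\le m+1$ and $0$ otherwise; $u_m=(1,\dots,1)^T\in\mathbb{R}^m$; and $v_{m,1}$ is the first standard unit column vector of $\mathbb{R}^m$. *)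

theory Defs
  imports Complex_Main "Jordan_Normal_Form.Matrix"
begin

(* The empty sum for n = 0 is made explicit, since (0 - 1) div 2 = 0 on nat. *)
function (sequential) T :: "nat \<Rightarrow> nat \<Rightarrow> nat" where
  "T n 0 = 1"
| "T n (Suc m) = T n m +
     (if n = 0 then 0 else (\<Sum>k = 0..(n - 1) div 2. T (2 * k) m * T (n - 1 - 2 * k) (Suc m)))"
  by pat_completeness auto
termination by (relation "measures [\<lambda>(n, m). m, \<lambda>(n, m). n]") auto

(* Matrix indices of the library start at 0, those of the formula i + j \<le> m + 1 at 1. *)
definition A :: "nat \<Rightarrow> real mat" where
  "A m = mat m m (\<lambda>(i, j). if (i + 1) + (j + 1) \<le> m + 1 then 1 else 0)"

definition u :: "nat \<Rightarrow> real vec" where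
  "u m = vec m (\<lambda>_. 1)"

(* The first standard unit vector has library index 0. *)
definition v1 :: "nat \<Rightarrow> real vec" where
  "v1 m = unit_vec m 0"

end

theory Submission
  imports Defs
begin

text \<open>
  The right-hand side counts the words \<open>x\<^sub>1 \<dots> x\<^sub>n\<close> over \<open>{0..m}\<close> with
  \<open>x\<^sub>i + x\<^sub>i\<^sub>+\<^sub>1 \<le> m\<close>. Replacing \<open>x\<^sub>i\<close> by \<open>m - x\<^sub>i\<close> at every odd position \<open>i\<close> turns them into the
  alternating words \<open>y\<^sub>1 \<ge> y\<^sub>2 \<le> y\<^sub>3 \<ge> \<dots>\<close>. Such a word either avoids the letter \<open>m\<close>, or
  its first \<open>m\<close> stands at an odd position \<open>2k + 1\<close>; in the latter case it splits into an alternating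
  word of length \<open>2k\<close> over \<open>{0..m-1}\<close> and, after complementing, one of length \<open>n - 1 - 2k\<close>
  over \<open>{0..m}\<close>. This is the recurrence of \<open>T\<close>.
\<close>

text \<open>For \<open>i \<le> m\<close>, the number of words \<open>x\<^sub>1 \<dots> x\<^sub>n\<close> as above that may follow the letter \<open>i\<close>.\<close>

fun walks :: "nat \<Rightarrow> nat \<Rightarrow> nat \<Rightarrow> nat" where
  "walks m 0 i = 1"
| "walks m (Suc n) i = (\<Sum>j\<le>m - i. walks m n j)"

lemma sum_parity_Suc:
  fixes f :: "nat \<Rightarrow> nat"
  shows "(\<Sum>j<Suc n. if even j then f j else 0) = f 0 + (\<Sum>j<n. if odd j then f (Suc j) else 0)"
    and "(\<Sum>j<Suc n. if odd j then f j else 0) = (\<Sum>j<n. if even j then f (Suc j) else 0)"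
  by (simp_all add: sum.lessThan_Suc_shift del: sum.lessThan_Suc)

text \<open>
  Decomposition at the first extremal letter. In the alternating picture the two equations describe
  the words following a valley \<open>i\<close> and a peak \<open>m - i\<close> of height at most \<open>m\<close>; only together do
  they admit an induction on the length.
\<close>

lemma walks_decomposition:
  assumes "i \<le> m"
  shows "walks (Suc m) n i = walks m n i
           + (\<Sum>j<n. if even j then walks m j i * walks (Suc m) (n - 1 - j) 0 else 0)"
    and "walks (Suc m) n (Suc i) = walks m n i
           + (\<Sum>j<n. if odd j then walks m j i * walks (Suc m) (n - 1 - j) 0 else 0)"
  using assms
proof (induction n arbitrary: i)
  case 0
  {
    case 1
    show ?case by simp
  next
    case 2
    show ?case by simp
  }
next
  case (Suc n)
  let ?w = "walks (Suc m)"
  have shift: "(\<Sum>c\<le>m - i. \<Sum>j<n. if P j then walks m j c * ?w (n - 1 - j) 0 else 0)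
      = (\<Sum>j<n. if P j then walks m (Suc j) i * ?w (n - Suc j) 0 else 0)" for P i
    by (subst sum.swap) (auto intro!: sum.cong simp: sum_distrib_right)
  {
    case 1
    then have "?w (Suc n) i = (\<Sum>c\<le>Suc (m - i). ?w n c)"
      by (simp add: Suc_diff_le)
    \<comment> \<open>The letter 0 yields the term \<open>j = 0\<close> of the even sum; all other
      letters are successors, covered by the second equation.\<close>
    also have "\<dots> = ?w n 0 + (\<Sum>c\<le>m - i. ?w n (Suc c))"
      by (rule sum.atMost_Suc_shift)
    also have "(\<Sum>c\<le>m - i. ?w n (Suc c)) = (\<Sum>c\<le>m - i. walks m n c
        + (\<Sum>j<n. if odd j then walks m j c * ?w (n - 1 - j) 0 else 0))"
      by (intro sum.cong refl Suc.IH(2)) auto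
    also have "\<dots> = walks m (Suc n) i
        + (\<Sum>j<n. if odd j then walks m (Suc j) i * ?w (n - Suc j) 0 else 0)"
      by (simp only: sum.distrib shift walks.simps)
    finally show ?case
      by (simp only: sum_parity_Suc) (simp cong: if_cong)
  next
    case 2
    have "?w (Suc n) (Suc i) = (\<Sum>c\<le>m - i. ?w n c)"
      by simp
    also have "\<dots> = (\<Sum>c\<le>m - i. walks m n c
        + (\<Sum>j<n. if even j then walks m j c * ?w (n - 1 - j) 0 else 0))"
      by (intro sum.cong refl Suc.IH(1)) auto
    also have "\<dots> = walks m (Suc n) i
        + (\<Sum>j<n. if even j then walks m (Suc j) i * ?w (n - Suc j) 0 else 0)"
      by (simp only: sum.distrib shift walks.simps)
    finally show ?case
      by (simp only: sum_parity_Suc) (simp cong: if_cong)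
  }
qed

lemma sum_even_lessThan:
  fixes f :: "nat \<Rightarrow> nat"
  assumes "n > 0"
  shows "(\<Sum>j<n. if even j then f j else 0) = (\<Sum>k = 0..(n - 1) div 2. f (2 * k))"
proof -
  have "{j \<in> {..<n}. even j} = (\<lambda>k. 2 * k) ` {0..(n - 1) div 2}"
    using assms by (auto elim!: evenE intro!: image_eqI)
  then show ?thesis
    by (simp add: sum.inter_filter[symmetric] sum.reindex inj_on_def)
qed

text \<open>Any letter may follow 0, so \<open>i = 0\<close> restricts nothing; there the first
  decomposition is the recurrence.\<close>

lemma T_eq_walks: "T n m = walks m n 0"
proof (induction n m rule: T.induct)
  case (1 n)
  show ?case by (induction n) auto
next
  case (2 n m)
  show ?case
  proof (cases "n = 0")
    case True
    then show ?thesis using 2 by simp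
  next
    case False
    have "(\<Sum>k = 0..(n - 1) div 2. T (2 * k) m * T (n - 1 - 2 * k) (Suc m))
        = (\<Sum>k = 0..(n - 1) div 2. walks m (2 * k) 0 * walks (Suc m) (n - 1 - 2 * k) 0)"
      using 2 False by (intro sum.cong refl) simp
    then show ?thesis
      using 2(1) False walks_decomposition(1)[of 0 m n] by (simp add: sum_even_lessThan)
  qed
qed

lemma A_carrier: "A m \<in> carrier_mat m m"
  by (simp add: A_def)

lemma A_mult_v1: "A (m + 1) *\<^sub>v v1 (m + 1) = u (m + 1)"
  by (rule eq_vecI) (auto simp: A_def v1_def u_def)

text \<open>With indices from 0, row \<open>i\<close> has its ones at the letters
  \<open>j \<le> m - i\<close> that may follow \<open>i\<close>.\<close>

lemma A_mult_walks:
  "A (m + 1) *\<^sub>v vec (m + 1) (\<lambda>i. real (walks m n i)) = vec (m + 1) (\<lambda>i. real (walks m (Suc n) i))"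
proof (rule eq_vecI)
  fix i
  assume "i < dim_vec (vec (m + 1) (\<lambda>i. real (walks m (Suc n) i)))"
  then have i: "i \<le> m" by simp
  have "(A (m + 1) *\<^sub>v vec (m + 1) (\<lambda>i. real (walks m n i))) $ i
      = (\<Sum>j<m + 1. if i + j \<le> m then real (walks m n j) else 0)"
    using i by (auto simp: A_def scalar_prod_def atLeast0LessThan intro!: sum.cong)
  also have "\<dots> = (\<Sum>j\<in>{j \<in> {..<m + 1}. i + j \<le> m}. real (walks m n j))"
    by (rule sum.inter_filter[symmetric]) simp
  also have "{j \<in> {..<m + 1}. i + j \<le> m} = {..m - i}"
    using i by auto
  finally show "(A (m + 1) *\<^sub>v vec (m + 1) (\<lambda>i. real (walks m n i))) $ i
      = vec (m + 1) (\<lambda>i. real (walks m (Suc n) i)) $ i"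
    using i by simp
qed (simp add: A_def)

lemma A_pow_mult_walks:
  "A (m + 1) ^\<^sub>m k *\<^sub>v vec (m + 1) (\<lambda>i. real (walks m n i))
     = vec (m + 1) (\<lambda>i. real (walks m (n + k) i))"
proof (induction k arbitrary: n)
  case 0
  then show ?case using A_carrier[of "m + 1"] by simp
next
  case (Suc k)
  have "A (m + 1) ^\<^sub>m Suc k *\<^sub>v vec (m + 1) (\<lambda>i. real (walks m n i))
      = A (m + 1) ^\<^sub>m k *\<^sub>v (A (m + 1) *\<^sub>v vec (m + 1) (\<lambda>i. real (walks m n i)))"
    by (simp add: assoc_mult_mat_vec[OF pow_carrier_mat[OF A_carrier] A_carrier] del: walks.simps)
  then show ?case
    by (simp only: A_mult_walks Suc.IH add_Suc_shift)
qed

text \<open>Pairing with \<open>u (m + 1)\<close> sums over all first letters, which amounts to one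
  more step, from 0.\<close>

lemma u_scalar_A_pow_mult_u:
  "u (m + 1) \<bullet> (A (m + 1) ^\<^sub>m n *\<^sub>v u (m + 1)) = real (walks m (Suc n) 0)"
proof -
  have "u (m + 1) = vec (m + 1) (\<lambda>i. real (walks m 0 i))"
    by (simp add: u_def)
  then have "A (m + 1) ^\<^sub>m n *\<^sub>v u (m + 1) = vec (m + 1) (\<lambda>i. real (walks m n i))"
    using A_pow_mult_walks[of m n 0] by simp
  then show ?thesis
    by (simp add: u_def scalar_prod_def atLeast0LessThan lessThan_Suc_atMost
        del: sum.lessThan_Suc sum.atMost_Suc)
qed

theorem theorem1p4:
  fixes m n :: nat
  shows "real (T n m) = u (m + 1) \<bullet> (A (m + 1) ^\<^sub>m n *\<^sub>v v1 (m + 1))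
    \<and> (n \<ge> 1 \<longrightarrow>
         u (m + 1) \<bullet> (A (m + 1) ^\<^sub>m n *\<^sub>v v1 (m + 1))
           = u (m + 1) \<bullet> (A (m + 1) ^\<^sub>m (n - 1) *\<^sub>v u (m + 1)))"
proof (cases n)
  case 0
  then show ?thesis
    using A_carrier[of "m + 1"] by (simp add: T_eq_walks u_def v1_def)
next
  case (Suc k)
  have "v1 (m + 1) \<in> carrier_vec (m + 1)"
    by (simp add: v1_def)
  then have "A (m + 1) ^\<^sub>m n *\<^sub>v v1 (m + 1) = A (m + 1) ^\<^sub>m k *\<^sub>v u (m + 1)"
    using assoc_mult_mat_vec[OF pow_carrier_mat[OF A_carrier] A_carrier] Suc
    by (simp add: A_mult_v1[unfolded Suc_eq_plus1[symmetric]])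
  then show ?thesis
    using Suc u_scalar_A_pow_mult_u[of m k] by (simp add: T_eq_walks)
qed

end
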